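(* Let $k\ge 0$ be an integer and let $\{p_n\}_{n=0}^k$ be a finite orthonormal polynomial sequence in $V(\mathcal{I},w)$, of Type A or of Type B. Define the functions $\beta_n^k$, $n=0,\dots,k$, on $\mathcal{I}$ by $$\beta_n^k(x)=\sum_{j=n}^k a_n^j\, p_j(x)$$ if $\{p_n\}_{n=0}^k$ is of Type A, with $p_n(x)=\sum_{i=0}^n a_i^n x^i$, or by $$\beta_n^k(x)=\sum_{i=0}^{\lfloor (k-n)/2\rfloor} a_i^{2i+n}\, p_{2i+n}(x)$$ if $\{p_n\}_{n=0}^k$ is of Type B, with $p_n(x)=\sum_{i=0}^{\lfloor n/2\rfloor} a_i^n x^{n-2i}$. Then the set $\{\beta_n^k\}_{n=0}^k$ is biorthogonal to the set of monomials $\{x^n\}_{n=0}^k$ on $\mathcal{I}$, i.e. $$\langle \beta_n^k, x^m\rangle=\delta_{n,m}\quad\text{for all } n,m\in\{0,\dots,k\}.$$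
   Context: $\mathcal{I}\subseteq\mathbb{R}$ is an interval and $w$ is a weight function with $w(x)\ge 0$ for all $x\in\mathcal{I}$. $V(\mathcal{I},w)$ denotes a finite-dimensional inner product space of real functions on $\mathcal{I}$ with inner product $\langle f,g\rangle=\int_{\mathcal{I}} f(x)g(x)w(x)\,dx$, containing the span $V_k$ of the monomials $x^0=1,x,\dots,x^k$ on $\mathcal{I}$. Superscripts on coefficients $a_i^n$ and on $\beta_n^k$ are labels, not powers; superscripts on the variable $x$ are powers. A Type A orthonormal polynomial sequence is a sequence of functions $p_n(x)=\sum_{i=0}^n a_i^n x^i$ with real coefficients and $a_n^n\neq 0$, such that $\langle p_n,p_m\rangle=\delta_{n,m}$. A Type B orthonormal polynomial sequence is a sequence of functions $p_n(x)=\sum_{i=0}^{\lfloor n/2\rfloor} a_i^n x^{n-2i}$ with real coefficients and $a_0^n\neq 0$, such that $\langle p_n,p_m\rangle=\delta_{n,m}$. Here $\lfloor\cdot\rfloor$ is the integer part and $\delta_{n,m}$ is the Kronecker delta. *)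

theory Defs
  imports "HOL-Analysis.Analysis" "HOL-Library.Function_Algebras"
begin

(* A real function on an interval I is represented by its extension by 0 to the whole line, so
   that equality of functions on I is equality in HOL and the linear algebra of functions on I
   takes place in the vector space of all functions real => real. *)

global_interpretation fun_space: vector_space "\<lambda>(c::real) (f::real \<Rightarrow> real) x. c * f x"
  by unfold_locales (auto simp: fun_eq_iff algebra_simps)

definition functions_on :: "real set \<Rightarrow> (real \<Rightarrow> real) set" where
  "functions_on I = {f. \<forall>x. x \<notin> I \<longrightarrow> f x = 0}"

definition monomial_on :: "real set \<Rightarrow> nat \<Rightarrow> real \<Rightarrow> real" where
  "monomial_on I n = (\<lambda>x. if x \<in> I then x ^ n else 0)"

definition weighted_inner :: "real set \<Rightarrow> (real \<Rightarrow> real) \<Rightarrow> (real \<Rightarrow> real) \<Rightarrow> (real \<Rightarrow> real) \<Rightarrow> real" where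
  "weighted_inner I w f g = (LINT x:I|lebesgue. f x * g x * w x)"

(* Symmetry, bilinearity and nonnegativity of weighted_inner on V follow from integrability of the
   products and w >= 0; existence of the integrals and definiteness are what has to be required. *)
definition weighted_inner_product_space ::
    "real set \<Rightarrow> (real \<Rightarrow> real) \<Rightarrow> (real \<Rightarrow> real) set \<Rightarrow> bool" where
  "weighted_inner_product_space I w V \<longleftrightarrow>
     is_interval I \<and> (\<forall>x\<in>I. 0 \<le> w x) \<and>
     V \<subseteq> functions_on I \<and> fun_space.subspace V \<and>
     (\<exists>B. finite B \<and> fun_space.span B = V) \<and>
     (\<forall>f\<in>V. \<forall>g\<in>V. set_integrable lebesgue I (\<lambda>x. f x * g x * w x)) \<and>
     (\<forall>f\<in>V. weighted_inner I w f f = 0 \<longrightarrow> f = 0)"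

definition orthonormal_upto ::
    "real set \<Rightarrow> (real \<Rightarrow> real) \<Rightarrow> nat \<Rightarrow> (nat \<Rightarrow> real \<Rightarrow> real) \<Rightarrow> bool" where
  "orthonormal_upto I w k p \<longleftrightarrow>
     (\<forall>n\<le>k. \<forall>m\<le>k. weighted_inner I w (p n) (p m) = (if n = m then 1 else 0))"

(* The coefficient with upper index n and lower index i is written a n i. *)

definition type_A_orthonormal ::
    "real set \<Rightarrow> (real \<Rightarrow> real) \<Rightarrow> (real \<Rightarrow> real) set \<Rightarrow> nat \<Rightarrow>
     (nat \<Rightarrow> nat \<Rightarrow> real) \<Rightarrow> (nat \<Rightarrow> real \<Rightarrow> real) \<Rightarrow> bool" where
  "type_A_orthonormal I w V k a p \<longleftrightarrow>
     (\<forall>n\<le>k. p n \<in> V \<and> a n n \<noteq> 0 \<and> (\<forall>x\<in>I. p n x = (\<Sum>i=0..n. a n i * x ^ i))) \<and>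
     orthonormal_upto I w k p"

definition type_B_orthonormal ::
    "real set \<Rightarrow> (real \<Rightarrow> real) \<Rightarrow> (real \<Rightarrow> real) set \<Rightarrow> nat \<Rightarrow>
     (nat \<Rightarrow> nat \<Rightarrow> real) \<Rightarrow> (nat \<Rightarrow> real \<Rightarrow> real) \<Rightarrow> bool" where
  "type_B_orthonormal I w V k a p \<longleftrightarrow>
     (\<forall>n\<le>k. p n \<in> V \<and> a n 0 \<noteq> 0 \<and>
        (\<forall>x\<in>I. p n x = (\<Sum>i=0..n div 2. a n i * x ^ (n - 2 * i)))) \<and>
     orthonormal_upto I w k p"

definition beta_A ::
    "nat \<Rightarrow> (nat \<Rightarrow> nat \<Rightarrow> real) \<Rightarrow> (nat \<Rightarrow> real \<Rightarrow> real) \<Rightarrow> nat \<Rightarrow> real \<Rightarrow> real" where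
  "beta_A k a p n = (\<lambda>x. \<Sum>j=n..k. a j n * p j x)"

definition beta_B ::
    "nat \<Rightarrow> (nat \<Rightarrow> nat \<Rightarrow> real) \<Rightarrow> (nat \<Rightarrow> real \<Rightarrow> real) \<Rightarrow> nat \<Rightarrow> real \<Rightarrow> real" where
  "beta_B k a p n = (\<lambda>x. \<Sum>i=0..(k - n) div 2. a (2 * i + n) i * p (2 * i + n) x)"

definition biorthogonal_upto ::
    "real set \<Rightarrow> (real \<Rightarrow> real) \<Rightarrow> nat \<Rightarrow> (nat \<Rightarrow> real \<Rightarrow> real) \<Rightarrow> (nat \<Rightarrow> real \<Rightarrow> real) \<Rightarrow> bool" where
  "biorthogonal_upto I w k f g \<longleftrightarrow>
     (\<forall>n\<le>k. \<forall>m\<le>k. weighted_inner I w (f n) (g m) = (if n = m then 1 else 0))"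

end

theory Submission imports Defs begin

text \<open>Orthonormality makes \<open>\<beta>\<^sub>n\<close> the function whose inner product with each \<open>p\<^sub>m\<close> is the
  coefficient of \<open>x\<^sup>n\<close> in \<open>p\<^sub>m\<close> (which is 0 for \<open>m < n\<close>). Thus the linear functionals
  \<open>\<langle>\<beta>\<^sub>n, _\<rangle>\<close> and "coefficient of \<open>x\<^sup>n\<close>" agree on all \<open>p\<^sub>m\<close>, \<open>m \<le> k\<close>. Since \<open>p\<^sub>m\<close> is a
  combination of \<open>1, \<dots>, x\<^sup>m\<close> with nonzero leading coefficient, they also agree on the
  monomials, by strong induction on the degree (\<open>beta_A_biorthogonal\<close>).

  A sequence of Type B is one of Type A in which every second coefficient vanishes; after
  padding the coefficients with these zeros (\<open>pad_coeffs\<close>), the two formulas for \<open>\<beta>\<^sub>n\<close>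
  coincide, so that Type B is a special case of Type A.\<close>

lemma weighted_inner_cong:
  assumes "\<And>x. x \<in> I \<Longrightarrow> f x = f' x" "\<And>x. x \<in> I \<Longrightarrow> g x = g' x"
  shows "weighted_inner I w f g = weighted_inner I w f' g'"
  unfolding weighted_inner_def set_lebesgue_integral_def
  by (rule Bochner_Integration.integral_cong) (auto simp: assms indicator_def)

lemma weighted_inner_commute: "weighted_inner I w f g = weighted_inner I w g f"
  by (simp add: weighted_inner_def mult.commute)

lemma weighted_inner_sum_left:
  assumes V: "weighted_inner_product_space I w V"
    and f: "\<And>j. j \<in> A \<Longrightarrow> f j \<in> V" and g: "g \<in> V"
  shows "weighted_inner I w (\<lambda>x. \<Sum>j\<in>A. c j * f j x) g
           = (\<Sum>j\<in>A. c j * weighted_inner I w (f j) g)"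
proof -
  have int: "integrable lebesgue (\<lambda>x. indicator I x * (f j x * g x * w x))" if "j \<in> A" for j
    using V f[OF that] g unfolding weighted_inner_product_space_def set_integrable_def by auto
  have "weighted_inner I w (\<lambda>x. \<Sum>j\<in>A. c j * f j x) g
      = (LINT x|lebesgue. (\<Sum>j\<in>A. c j * (indicator I x * (f j x * g x * w x))))"
    unfolding weighted_inner_def set_lebesgue_integral_def
    by (simp add: sum_distrib_left sum_distrib_right mult_ac)
  also have "\<dots> = (\<Sum>j\<in>A. (LINT x|lebesgue. c j * (indicator I x * (f j x * g x * w x))))"
    by (rule Bochner_Integration.integral_sum) (use int in auto)
  also have "\<dots> = (\<Sum>j\<in>A. c j * weighted_inner I w (f j) g)"
    unfolding weighted_inner_def set_lebesgue_integral_def by simp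
  finally show ?thesis .
qed

lemma linear_combination_mem:
  assumes V: "fun_space.subspace V" and "\<And>j. j \<in> A \<Longrightarrow> f j \<in> V"
  shows "(\<lambda>x. \<Sum>j\<in>A. c j * f j x) \<in> V"
proof -
  have "(\<Sum>j\<in>A. (\<lambda>x. c j * f j x)) \<in> V"
    by (intro fun_space.subspace_sum[OF V] fun_space.subspace_scale[OF V] assms(2))
  also have "(\<Sum>j\<in>A. (\<lambda>x. c j * f j x)) = (\<lambda>x. \<Sum>j\<in>A. c j * f j x)"
    by (induction A rule: infinite_finite_induct) (auto simp: fun_eq_iff)
  finally show ?thesis .
qed

text \<open>In the induction step, pairing \<open>\<beta>\<^sub>n\<close> with the expansion of \<open>p\<^sub>m\<close> leaves
  \<open>\<langle>\<beta>\<^sub>n, x\<^sup>m\<rangle>\<close> as the only unknown value, and its factor \<open>a m m\<close> is nonzero.\<close>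

lemma beta_A_biorthogonal:
  assumes V: "weighted_inner_product_space I w V"
    and mono: "fun_space.span (monomial_on I ` {0..k}) \<subseteq> V"
    and A: "type_A_orthonormal I w V k a p"
  shows "biorthogonal_upto I w k (beta_A k a p) (monomial_on I)"
  unfolding biorthogonal_upto_def
proof (intro allI impI)
  fix n m assume n: "n \<le> k" and "m \<le> k"
  have p: "p j \<in> V" "a j j \<noteq> 0" "\<And>x. x \<in> I \<Longrightarrow> p j x = (\<Sum>i=0..j. a j i * x ^ i)"
    if "j \<le> k" for j
    using A that by (auto simp: type_A_orthonormal_def)
  have orth: "weighted_inner I w (p i) (p j) = (if i = j then 1 else 0)"
    if "i \<le> k" "j \<le> k" for i j
    using A that by (auto simp: type_A_orthonormal_def orthonormal_upto_def)
  have mono_mem: "monomial_on I i \<in> V" if "i \<le> k" for i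
    using mono that fun_space.span_base[of "monomial_on I i" "monomial_on I ` {0..k}"] by auto
  have "fun_space.subspace V" using V by (simp add: weighted_inner_product_space_def)
  then have beta_mem: "beta_A k a p n \<in> V"
    unfolding beta_A_def by (rule linear_combination_mem) (use p in auto)
  have beta_p: "weighted_inner I w (beta_A k a p n) (p j) = (if n \<le> j then a j n else 0)"
    if j: "j \<le> k" for j
  proof -
    have "weighted_inner I w (beta_A k a p n) (p j)
        = (\<Sum>i=n..k. a i n * weighted_inner I w (p i) (p j))"
      unfolding beta_A_def by (rule weighted_inner_sum_left[OF V]) (use p j in auto)
    also have "\<dots> = (\<Sum>i=n..k. if i = j then a j n else 0)"
      by (rule sum.cong) (use orth j in auto)
    finally show ?thesis using j by simp
  qed
  show "weighted_inner I w (beta_A k a p n) (monomial_on I m) = (if n = m then 1 else 0)"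
    using \<open>m \<le> k\<close>
  proof (induction m rule: less_induct)
    case (less m)
    let ?B = "\<lambda>i. weighted_inner I w (beta_A k a p n) (monomial_on I i)"
    have "(if n \<le> m then a m n else 0) = weighted_inner I w (p m) (beta_A k a p n)"
      using beta_p less.prems by (simp add: weighted_inner_commute)
    also have "\<dots> = weighted_inner I w (\<lambda>x. \<Sum>i=0..m. a m i * monomial_on I i x) (beta_A k a p n)"
      by (rule weighted_inner_cong) (use p less.prems in \<open>auto simp: monomial_on_def\<close>)
    also have "\<dots> = (\<Sum>i=0..m. a m i * weighted_inner I w (monomial_on I i) (beta_A k a p n))"
      by (rule weighted_inner_sum_left[OF V]) (use mono_mem beta_mem less.prems in auto)
    also have "\<dots> = (\<Sum>i<m. a m i * ?B i) + a m m * ?B m"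
      by (simp add: weighted_inner_commute[of I w _ "beta_A k a p n"] atLeast0AtMost
          flip: lessThan_Suc_atMost)
    also have "(\<Sum>i<m. a m i * ?B i) = (\<Sum>i<m. if n = i then a m i else 0)"
      by (rule sum.cong) (use less in auto)
    finally have "a m m * ?B m = (if n = m then a m m else 0)"
      by (auto split: if_splits)
    then show ?case using p(2)[OF less.prems] by (auto split: if_splits)
  qed
qed

text \<open>Type B coefficients are indexed from the leading term downwards in steps of two; here the
  second index is turned into the exponent of \<open>x\<close>.\<close>

definition pad_coeffs :: "(nat \<Rightarrow> nat \<Rightarrow> real) \<Rightarrow> nat \<Rightarrow> nat \<Rightarrow> real" where
  "pad_coeffs a n j = (if j \<le> n \<and> even (n - j) then a n ((n - j) div 2) else 0)"

lemma type_A_pad_coeffs: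
  assumes "type_B_orthonormal I w V k a p"
  shows "type_A_orthonormal I w V k (pad_coeffs a) p"
proof -
  have "(\<Sum>i=0..n div 2. a n i * x ^ (n - 2 * i)) = (\<Sum>j=0..n. pad_coeffs a n j * x ^ j)"
    for n and x :: real
  proof -
    have "(\<Sum>i=0..n div 2. a n i * x ^ (n - 2 * i))
        = (\<Sum>j\<in>{j \<in> {0..n}. even (n - j)}. pad_coeffs a n j * x ^ j)"
      by (rule sum.reindex_bij_witness[where i = "\<lambda>j. (n - j) div 2" and j = "\<lambda>i. n - 2 * i"])
        (auto simp: pad_coeffs_def)
    also have "\<dots> = (\<Sum>j=0..n. pad_coeffs a n j * x ^ j)"
      by (rule sum.mono_neutral_left) (auto simp: pad_coeffs_def)
    finally show ?thesis .
  qed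
  then show ?thesis
    using assms unfolding type_A_orthonormal_def type_B_orthonormal_def
    by (simp add: pad_coeffs_def)
qed

lemma beta_A_pad_coeffs:
  assumes "n \<le> k"
  shows "beta_A k (pad_coeffs a) p n = beta_B k a p n"
proof
  fix x
  have "beta_B k a p n x = (\<Sum>j\<in>{j \<in> {n..k}. even (j - n)}. pad_coeffs a j n * p j x)"
    unfolding beta_B_def
    by (rule sum.reindex_bij_witness[where i = "\<lambda>j. (j - n) div 2" and j = "\<lambda>i. 2 * i + n"])
      (use assms in \<open>auto simp: pad_coeffs_def div_le_mono\<close>)
  also have "\<dots> = beta_A k (pad_coeffs a) p n x"
    unfolding beta_A_def by (rule sum.mono_neutral_left) (auto simp: pad_coeffs_def)
  finally show "beta_A k (pad_coeffs a) p n x = beta_B k a p n x" by simp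
qed

theorem mainTheorem2:
  fixes I :: "real set" and w :: "real \<Rightarrow> real" and V :: "(real \<Rightarrow> real) set"
    and k :: nat and a :: "nat \<Rightarrow> nat \<Rightarrow> real" and p :: "nat \<Rightarrow> real \<Rightarrow> real"
  assumes "weighted_inner_product_space I w V"
    and "fun_space.span (monomial_on I ` {0..k}) \<subseteq> V"
  shows "(type_A_orthonormal I w V k a p \<longrightarrow>
            biorthogonal_upto I w k (beta_A k a p) (monomial_on I)) \<and>
         (type_B_orthonormal I w V k a p \<longrightarrow>
            biorthogonal_upto I w k (beta_B k a p) (monomial_on I))"
proof (intro conjI impI)
  assume "type_A_orthonormal I w V k a p"
  with assms show "biorthogonal_upto I w k (beta_A k a p) (monomial_on I)"
    by (rule beta_A_biorthogonal)
next
  assume "type_B_orthonormal I w V k a p"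
  then have "type_A_orthonormal I w V k (pad_coeffs a) p"
    by (rule type_A_pad_coeffs)
  with assms have "biorthogonal_upto I w k (beta_A k (pad_coeffs a) p) (monomial_on I)"
    by (rule beta_A_biorthogonal)
  then show "biorthogonal_upto I w k (beta_B k a p) (monomial_on I)"
    by (simp add: biorthogonal_upto_def beta_A_pad_coeffs)
qed

end
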